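(* The proof system ${\bf EMN^\Delta}$ is strongly complete with respect to the class of $(mn)$-frames, i.e. the class of all neighborhood frames possessing both properties $(m)$ and $(n)$.
   Context: Fix a nonempty set $\mathbf{P}$ of propositional variables. The language $\mathcal{L}(\Delta)$ is given by $\varphi::=p\in\mathbf{P}\mid\neg\varphi\mid\varphi\land\varphi\mid\Delta\varphi$; $\vee,\to,\leftrightarrow,\top$ are the usual abbreviations. A neighborhood frame is a pair $\langle S,N\rangle$ with $S$ a nonempty set and $N:S\to\mathcal{P}(\mathcal{P}(S))$; a neighborhood model $\mathcal{M}=\langle S,N,V\rangle$ adds a valuation $V$ assigning a set $V(p)\subseteq S$ to each $p\in\mathbf{P}$. Truth: $\mathcal{M},s\vDash p$ iff $s\in V(p)$; Boolean clauses as usual; $\mathcal{M},s\vDash\Delta\varphi$ iff $\varphi^{\mathcal{M}}\in N(s)$ or $S\setminus\varphi^{\mathcal{M}}\in N(s)$, where $\varphi^{\mathcal{M}}=\{s\in S\mid\mathcal{M},s\vDash\varphi\}$. Frame properties (required for every $s\in S$): $(m)$: $X\in N(s)$ and $X\subseteq Y\subseteq S$ imply $Y\in N(s)$; $(n)$: $S\in N(s)$. The system ${\bf EMN^\Delta}$ has as axiom schemas all instances of propositional tautologies (TAUT), $\Delta\text{Equ}$: $\Delta\varphi\leftrightarrow\Delta\neg\varphi$, $\Delta\text{M}$: $\Delta\varphi\to\Delta(\varphi\vee\psi)\vee\Delta(\neg\varphi\vee\chi)$, and $\Delta\text{N}$: $\Delta\top$; its rules are MP (from $\varphi$ and $\varphi\to\psi$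 infer $\psi$) and $\text{RE}\Delta$ (from $\varphi\leftrightarrow\psi$ infer $\Delta\varphi\leftrightarrow\Delta\psi$). A set $\Gamma$ of formulas is consistent in a system $\Lambda$ if there are no $\gamma_1,\dots,\gamma_n\in\Gamma$ such that $\neg(\gamma_1\land\dots\land\gamma_n)$ is a theorem of $\Lambda$. $\Lambda$ is strongly complete with respect to a class $\mathbb{K}$ of frames if every $\Lambda$-consistent set of formulas is satisfied (all members true) at some state of some model based on a frame in $\mathbb{K}$. *)

theory Defs
  imports Main
begin

text \<open>The set of propositional variables is the type \<open>'p\<close>, which is nonempty as every HOL type.\<close>

datatype 'p fm =
    Atom 'p
  | Neg "'p fm"
  | Con "'p fm" "'p fm"
  | Noncont "'p fm"  (\<open>\<Delta> _\<close> [90] 90)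

abbreviation Dis :: "'p fm \<Rightarrow> 'p fm \<Rightarrow> 'p fm" where
  "Dis \<phi> \<psi> \<equiv> Neg (Con (Neg \<phi>) (Neg \<psi>))"

abbreviation Imp :: "'p fm \<Rightarrow> 'p fm \<Rightarrow> 'p fm" where
  "Imp \<phi> \<psi> \<equiv> Neg (Con \<phi> (Neg \<psi>))"

abbreviation Iff :: "'p fm \<Rightarrow> 'p fm \<Rightarrow> 'p fm" where
  "Iff \<phi> \<psi> \<equiv> Con (Imp \<phi> \<psi>) (Imp \<psi> \<phi>)"

text \<open>As usual in a language without truth constants, \<open>Top\<close> is excluded middle for a fixed
  arbitrary variable.\<close>

definition Top :: "'p fm" where
  "Top = (let p = Atom (SOME p. True) in Dis p (Neg p))"


record 'w nframe =
  states :: "'w set"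
  nbhds :: "'w \<Rightarrow> 'w set set"

record ('w, 'p) nmodel = "'w nframe" +
  val :: "'p \<Rightarrow> 'w set"

definition is_nframe :: "'w nframe \<Rightarrow> bool" where
  "is_nframe F \<longleftrightarrow> states F \<noteq> {} \<and> (\<forall>s\<in>states F. nbhds F s \<subseteq> Pow (states F))"

definition frame_of :: "('w, 'p) nmodel \<Rightarrow> 'w nframe" where
  "frame_of M = \<lparr>states = states M, nbhds = nbhds M\<rparr>"

definition is_nmodel :: "('w, 'p) nmodel \<Rightarrow> bool" where
  "is_nmodel M \<longleftrightarrow> is_nframe (frame_of M) \<and> (\<forall>p. val M p \<subseteq> states M)"

text \<open>Truth is meant to be used only at states \<open>s \<in> states M\<close>.\<close>

primrec sat :: "('w, 'p) nmodel \<Rightarrow> 'w \<Rightarrow> 'p fm \<Rightarrow> bool" where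
  "sat M s (Atom p) \<longleftrightarrow> s \<in> val M p"
| "sat M s (Neg \<phi>) \<longleftrightarrow> \<not> sat M s \<phi>"
| "sat M s (Con \<phi> \<psi>) \<longleftrightarrow> sat M s \<phi> \<and> sat M s \<psi>"
| "sat M s (\<Delta> \<phi>) \<longleftrightarrow>
     {t \<in> states M. sat M t \<phi>} \<in> nbhds M s \<or>
     states M - {t \<in> states M. sat M t \<phi>} \<in> nbhds M s"

definition prop_m :: "'w nframe \<Rightarrow> bool" where
  "prop_m F \<longleftrightarrow> (\<forall>s\<in>states F. \<forall>X Y.
     X \<in> nbhds F s \<longrightarrow> X \<subseteq> Y \<longrightarrow> Y \<subseteq> states F \<longrightarrow> Y \<in> nbhds F s)"

definition prop_n :: "'w nframe \<Rightarrow> bool" where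
  "prop_n F \<longleftrightarrow> (\<forall>s\<in>states F. states F \<in> nbhds F s)"

definition mn_frames :: "'w nframe set" where
  "mn_frames = {F. is_nframe F \<and> prop_m F \<and> prop_n F}"


text \<open>Purely propositional formulas over countably many letters. The letters are kept separate from
  \<open>'p\<close>, which may be finite, so that instances of all propositional tautologies are available.\<close>

datatype pfm = PVar nat | PNeg pfm | PCon pfm pfm

primrec peval :: "(nat \<Rightarrow> bool) \<Rightarrow> pfm \<Rightarrow> bool" where
  "peval v (PVar n) \<longleftrightarrow> v n"
| "peval v (PNeg A) \<longleftrightarrow> \<not> peval v A"
| "peval v (PCon A B) \<longleftrightarrow> peval v A \<and> peval v B"

primrec inst :: "(nat \<Rightarrow> 'p fm) \<Rightarrow> pfm \<Rightarrow> 'p fm" where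
  "inst \<sigma> (PVar n) = \<sigma> n"
| "inst \<sigma> (PNeg A) = Neg (inst \<sigma> A)"
| "inst \<sigma> (PCon A B) = Con (inst \<sigma> A) (inst \<sigma> B)"

definition tautology :: "pfm \<Rightarrow> bool" where
  "tautology A \<longleftrightarrow> (\<forall>v. peval v A)"

inductive EMN_thm :: "'p fm \<Rightarrow> bool" where
  TAUT: "tautology A \<Longrightarrow> EMN_thm (inst \<sigma> A)"
| DeltaEqu: "EMN_thm (Iff (\<Delta> \<phi>) (\<Delta> (Neg \<phi>)))"
| DeltaM: "EMN_thm (Imp (\<Delta> \<phi>) (Dis (\<Delta> (Dis \<phi> \<psi>)) (\<Delta> (Dis (Neg \<phi>) \<chi>))))"
| DeltaN: "EMN_thm (\<Delta> Top)"
| MP: "EMN_thm \<phi> \<Longrightarrow> EMN_thm (Imp \<phi> \<psi>) \<Longrightarrow> EMN_thm \<psi>"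
| REDelta: "EMN_thm (Iff \<phi> \<psi>) \<Longrightarrow> EMN_thm (Iff (\<Delta> \<phi>) (\<Delta> \<psi>))"


text \<open>A proof system is represented by its set of theorems. The list \<open>\<gamma> # \<gamma>s\<close> below is
  \<open>\<gamma>\<^sub>1, \<dots>, \<gamma>\<^sub>n\<close> with \<open>n \<ge> 1\<close>.\<close>

definition consistent :: "('p fm \<Rightarrow> bool) \<Rightarrow> 'p fm set \<Rightarrow> bool" where
  "consistent L \<Gamma> \<longleftrightarrow>
     \<not> (\<exists>\<gamma> \<gamma>s. set (\<gamma> # \<gamma>s) \<subseteq> \<Gamma> \<and> L (Neg (foldl Con \<gamma> \<gamma>s)))"

text \<open>HOL cannot quantify existentially over types, so the type \<open>'w\<close> from which the states are drawn
  is a parameter. Strong completeness for one particular choice of \<open>'w\<close> yields the existence of a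
  model with no restriction on the nature of its states.\<close>

definition strongly_complete :: "('p fm \<Rightarrow> bool) \<Rightarrow> 'w nframe set \<Rightarrow> bool" where
  "strongly_complete L K \<longleftrightarrow>
     (\<forall>\<Gamma>. consistent L \<Gamma> \<longrightarrow>
       (\<exists>M. is_nmodel M \<and> frame_of M \<in> K \<and> (\<exists>s\<in>states M. \<forall>\<phi>\<in>\<Gamma>. sat M s \<phi>)))"

end

theory Submission
  imports Defs
begin

text \<open>
  The proof is a canonical model construction. Worlds are the sets of formulas that contain all
  theorems and whose membership predicate respects the Boolean connectives, that is, the maximal
  consistent sets; a Zorn argument (\<open>consistent_extends_to_world\<close>) extends every nonempty
  consistent set to a world.

  The difficulty is that \<open>\<Delta> \<phi>\<close> says that \<open>\<phi>\<close> or its negation is necessary without saying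
  which, while the neighborhoods must be closed under supersets. The choice is made by
  calling \<open>\<phi>\<close> \<^emph>\<open>necessary at\<close> a world \<open>s\<close> if \<open>\<Delta> (\<phi> \<or> \<psi>)\<close> is in \<open>s\<close> for every \<open>\<psi>\<close>: in a
  monotone frame everything weaker than a necessary formula is necessary, hence noncontingent. Axiom
  \<open>\<Delta>\<close>M says exactly that if \<open>\<Delta> \<phi>\<close> is in \<open>s\<close>, then \<open>\<phi>\<close> or its negation is necessary at \<open>s\<close>.
  The neighborhoods of \<open>s\<close> are the sets of worlds that include the truth set of some formula
  necessary at \<open>s\<close>, so that \<open>(m)\<close> holds by construction, and \<open>\<Delta>\<close>N, with the replacement of
  equivalents, makes \<open>Top\<close> necessary everywhere and so gives \<open>(n)\<close>.

  Closing under supersets adds nothing wrong: if the truth set of \<open>\<phi>\<close> includes that of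
  some necessary \<open>\<chi>\<close>, then \<open>\<phi>\<close> is equivalent to \<open>\<chi> \<or> \<phi>\<close>, so \<open>\<Delta> \<phi>\<close> is in \<open>s\<close>. This gives the
  truth lemma \<open>sat_canonical_model\<close>.
\<close>


section \<open>Propositional reasoning\<close>

text \<open>Formulas \<open>Atom p\<close> and \<open>\<Delta> \<phi>\<close> are treated alike, as propositionally atomic, so a Boolean
  valuation may give them arbitrary values.\<close>

definition boolean :: "('p fm \<Rightarrow> bool) \<Rightarrow> bool" where
  "boolean g \<longleftrightarrow> (\<forall>\<phi>. g (Neg \<phi>) \<longleftrightarrow> \<not> g \<phi>) \<and> (\<forall>\<phi> \<psi>. g (Con \<phi> \<psi>) \<longleftrightarrow> g \<phi> \<and> g \<psi>)"

lemma boolean_Neg: "boolean g \<Longrightarrow> g (Neg \<phi>) \<longleftrightarrow> \<not> g \<phi>"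
  and boolean_Con: "boolean g \<Longrightarrow> g (Con \<phi> \<psi>) \<longleftrightarrow> g \<phi> \<and> g \<psi>"
  unfolding boolean_def by blast+

lemma boolean_Top: "boolean g \<Longrightarrow> g Top"
  by (simp add: Top_def Let_def boolean_Neg boolean_Con)

lemmas boolean_simps = boolean_Neg boolean_Con boolean_Top

lemma boolean_foldl_Con:
  "boolean g \<Longrightarrow> g (foldl Con \<gamma> \<gamma>s) \<longleftrightarrow> (\<forall>\<phi>\<in>set (\<gamma> # \<gamma>s). g \<phi>)"
  by (induction \<gamma>s arbitrary: \<gamma>) (auto simp: boolean_simps)

primrec prop_atoms :: "'p fm \<Rightarrow> 'p fm set" where
  "prop_atoms (Atom p) = {Atom p}"
| "prop_atoms (Neg \<phi>) = prop_atoms \<phi>"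
| "prop_atoms (Con \<phi> \<psi>) = prop_atoms \<phi> \<union> prop_atoms \<psi>"
| "prop_atoms (\<Delta> \<phi>) = {\<Delta> \<phi>}"

primrec prop_skeleton :: "('p fm \<Rightarrow> nat) \<Rightarrow> 'p fm \<Rightarrow> pfm" where
  "prop_skeleton f (Atom p) = PVar (f (Atom p))"
| "prop_skeleton f (Neg \<phi>) = PNeg (prop_skeleton f \<phi>)"
| "prop_skeleton f (Con \<phi> \<psi>) = PCon (prop_skeleton f \<phi>) (prop_skeleton f \<psi>)"
| "prop_skeleton f (\<Delta> \<phi>) = PVar (f (\<Delta> \<phi>))"

lemma finite_prop_atoms: "finite (prop_atoms \<phi>)"
  by (induction \<phi>) auto

lemma inst_prop_skeleton:
  "\<forall>\<alpha>\<in>prop_atoms \<phi>. \<sigma> (f \<alpha>) = \<alpha> \<Longrightarrow> inst \<sigma> (prop_skeleton f \<phi>) = \<phi>"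
  by (induction \<phi>) auto

lemma boolean_peval_prop_skeleton: "boolean (\<lambda>\<phi>. peval v (prop_skeleton f \<phi>))"
  by (simp add: boolean_def)

text \<open>This turns the syntactic schema of tautology instances into a semantic criterion. The type of
  formulas may be uncountable, so propositional letters can be assigned only to the finitely many
  atoms of the formula at hand.\<close>

lemma EMN_thm_if_boolean_valid:
  assumes valid: "\<And>g. boolean g \<Longrightarrow> g \<phi>"
  shows "EMN_thm \<phi>"
proof -
  obtain f :: "'a fm \<Rightarrow> nat" where f: "inj_on f (prop_atoms \<phi>)"
    using finite_imp_inj_to_nat_seg[OF finite_prop_atoms] by metis
  define \<sigma> where "\<sigma> = inv_into (prop_atoms \<phi>) f"
  have "tautology (prop_skeleton f \<phi>)"
    unfolding tautology_def using valid[OF boolean_peval_prop_skeleton] by blast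
  then have "EMN_thm (inst \<sigma> (prop_skeleton f \<phi>))"
    by (rule TAUT)
  moreover have "inst \<sigma> (prop_skeleton f \<phi>) = \<phi>"
    by (rule inst_prop_skeleton) (simp add: \<sigma>_def f)
  ultimately show ?thesis
    by simp
qed

lemma EMN_thm_Top: "EMN_thm Top"
  by (rule EMN_thm_if_boolean_valid) (rule boolean_Top)

lemma EMN_thm_boolean_consequence:
  assumes "EMN_thm \<theta>" and "\<And>g. boolean g \<Longrightarrow> g \<theta> \<Longrightarrow> g \<phi>"
  shows "EMN_thm \<phi>"
proof (rule MP[OF assms(1)])
  show "EMN_thm (Imp \<theta> \<phi>)"
    by (rule EMN_thm_if_boolean_valid) (use assms(2) in \<open>auto simp: boolean_simps\<close>)
qed

lemma EMN_thm_boolean_consequence2: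
  assumes "EMN_thm \<theta>" and "EMN_thm \<eta>" and "\<And>g. boolean g \<Longrightarrow> g \<theta> \<Longrightarrow> g \<eta> \<Longrightarrow> g \<phi>"
  shows "EMN_thm \<phi>"
proof (rule MP[OF assms(2)])
  show "EMN_thm (Imp \<eta> \<phi>)"
    by (rule EMN_thm_boolean_consequence[OF assms(1)])
      (use assms(3) in \<open>auto simp: boolean_simps\<close>)
qed


section \<open>Worlds\<close>

definition world :: "'p fm set \<Rightarrow> bool" where
  "world w \<longleftrightarrow> boolean (\<lambda>\<phi>. \<phi> \<in> w) \<and> (\<forall>\<phi>. EMN_thm \<phi> \<longrightarrow> \<phi> \<in> w)"

lemma world_Neg: "world w \<Longrightarrow> Neg \<phi> \<in> w \<longleftrightarrow> \<phi> \<notin> w"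
  and world_Con: "world w \<Longrightarrow> Con \<phi> \<psi> \<in> w \<longleftrightarrow> \<phi> \<in> w \<and> \<psi> \<in> w"
  and world_Top: "world w \<Longrightarrow> Top \<in> w"
  and world_EMN_thm: "world w \<Longrightarrow> EMN_thm \<phi> \<Longrightarrow> \<phi> \<in> w"
  unfolding world_def
  using boolean_simps[of "\<lambda>\<phi>. \<phi> \<in> w"] by auto

lemmas world_simps = world_Neg world_Con world_Top

text \<open>Consistency is a condition on finite subsets, and a finite subset of the union of a chain
  already lies in a member of the chain.\<close>

lemma consistent_Union_chain:
  assumes chain: "subset.chain A \<C>" and ne: "\<C> \<noteq> {}"
    and cons: "\<And>\<Gamma>. \<Gamma> \<in> \<C> \<Longrightarrow> consistent L \<Gamma>"
  shows "consistent L (\<Union>\<C>)"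
  unfolding consistent_def
proof (rule notI, elim exE conjE)
  fix \<gamma> \<gamma>s
  assume sub: "set (\<gamma> # \<gamma>s) \<subseteq> \<Union>\<C>" and L: "L (Neg (foldl Con \<gamma> \<gamma>s))"
  obtain \<Gamma> where "\<Gamma> \<in> \<C>" "set (\<gamma> # \<gamma>s) \<subseteq> \<Gamma>"
    using finite_subset_Union_chain[OF _ sub ne chain] by auto
  with cons L show False
    unfolding consistent_def by blast
qed

text \<open>Lindenbaum's lemma. A member of \<open>\<Gamma>\<close> guarantees that the system itself is consistent: in an
  inconsistent system its negation would be a theorem. The consistency of the empty set, by
  contrast, says nothing about the system, because only nonempty conjunctions are considered.\<close>

lemma consistent_extends_to_world:
  assumes cons: "consistent EMN_thm \<Gamma>" and ne: "\<Gamma> \<noteq> {}"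
  obtains w where "world w" and "\<Gamma> \<subseteq> w"
proof -
  let ?A = "{\<Theta>. \<Gamma> \<subseteq> \<Theta> \<and> consistent EMN_thm \<Theta>}"
  have maximal: "\<exists>w\<in>?A. \<forall>\<Theta>\<in>?A. w \<subseteq> \<Theta> \<longrightarrow> \<Theta> = w"
  proof (rule subset_Zorn_nonempty)
    show "?A \<noteq> {}"
      using cons by blast
  next
    fix \<C> assume \<C>: "\<C> \<noteq> {}" "subset.chain ?A \<C>"
    then have "\<C> \<subseteq> ?A"
      by (simp add: subset.chain_def)
    then have "consistent EMN_thm (\<Union>\<C>)"
      by (intro consistent_Union_chain[OF \<C>(2,1)]) blast
    moreover have "\<Gamma> \<subseteq> \<Union>\<C>"
      using \<C>(1) \<open>\<C> \<subseteq> ?A\<close> by blast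
    ultimately show "\<Union>\<C> \<in> ?A"
      by simp
  qed
  obtain w where \<Gamma>w: "\<Gamma> \<subseteq> w" and w: "consistent EMN_thm w"
    and max_in: "\<forall>\<Theta>\<in>?A. w \<subseteq> \<Theta> \<longrightarrow> \<Theta> = w"
    using maximal by blast
  have max: "\<Theta> = w" if "w \<subseteq> \<Theta>" "consistent EMN_thm \<Theta>" for \<Theta>
    using max_in \<Gamma>w that by (simp add: subset_trans)
  obtain \<gamma>0 where \<gamma>0: "\<gamma>0 \<in> w"
    using ne \<Gamma>w by blast
  have refutable: "\<exists>\<gamma>s. set \<gamma>s \<subseteq> w \<and> EMN_thm (Neg (foldl Con \<phi> \<gamma>s))" if "\<phi> \<notin> w" for \<phi>
  proof -
    have "\<not> consistent EMN_thm (insert \<phi> w)"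
      using max[of "insert \<phi> w"] that by blast
    then obtain \<gamma> \<gamma>s where sub: "set (\<gamma> # \<gamma>s) \<subseteq> insert \<phi> w"
      and refuted: "EMN_thm (Neg (foldl Con \<gamma> \<gamma>s))"
      unfolding consistent_def by blast
    let ?\<gamma>s = "filter (\<lambda>\<psi>. \<psi> \<noteq> \<phi>) (\<gamma> # \<gamma>s)"
    have "EMN_thm (Neg (foldl Con \<phi> ?\<gamma>s))"
      by (rule EMN_thm_boolean_consequence[OF refuted])
        (auto simp: boolean_Neg boolean_foldl_Con simp del: filter.simps)
    moreover have "set ?\<gamma>s \<subseteq> w"
      using sub by auto
    ultimately show ?thesis
      by blast
  qed
  \<comment> \<open>The element \<open>\<gamma>0\<close> pads a possibly empty list of premises, since consistency speaks of nonempty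
    conjunctions only.\<close>
  have closed: "\<phi> \<in> w"
    if "set \<gamma>s \<subseteq> w" and \<theta>: "EMN_thm \<theta>"
      and cq: "\<And>g. boolean g \<Longrightarrow> \<forall>\<gamma>\<in>set \<gamma>s. g \<gamma> \<Longrightarrow> g \<theta> \<Longrightarrow> g \<phi>" for \<gamma>s \<theta> \<phi>
  proof (rule ccontr)
    assume "\<phi> \<notin> w"
    then obtain \<delta>s where \<delta>s: "set \<delta>s \<subseteq> w" and refuted: "EMN_thm (Neg (foldl Con \<phi> \<delta>s))"
      using refutable by blast
    have "EMN_thm (Neg (foldl Con \<gamma>0 (\<gamma>s @ \<delta>s)))"
      by (rule EMN_thm_boolean_consequence2[OF \<theta> refuted])
        (use cq in \<open>auto simp: boolean_Neg boolean_foldl_Con simp del: foldl_append\<close>)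
    moreover have "set (\<gamma>0 # \<gamma>s @ \<delta>s) \<subseteq> w"
      using \<gamma>0 \<delta>s that(1) by simp
    ultimately show False
      using w unfolding consistent_def by blast
  qed
  have thms: "\<phi> \<in> w" if "EMN_thm \<phi>" for \<phi>
    using closed[of "[]", OF _ that] by simp
  have closed': "\<phi> \<in> w"
    if "set \<gamma>s \<subseteq> w" and "\<And>g. boolean g \<Longrightarrow> \<forall>\<gamma>\<in>set \<gamma>s. g \<gamma> \<Longrightarrow> g \<phi>" for \<gamma>s \<phi>
    using that EMN_thm_Top by (intro closed[of \<gamma>s Top]) auto
  have Con: "Con \<phi> \<psi> \<in> w \<longleftrightarrow> \<phi> \<in> w \<and> \<psi> \<in> w" for \<phi> \<psi>
  proof (intro iffI conjI; (elim conjE)?)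
    assume "\<phi> \<in> w" "\<psi> \<in> w"
    then show "Con \<phi> \<psi> \<in> w"
      by (intro closed'[of "[\<phi>, \<psi>]"]) (simp_all add: boolean_Con)
  next
    assume "Con \<phi> \<psi> \<in> w"
    then show "\<phi> \<in> w"
      by (intro closed'[of "[Con \<phi> \<psi>]"]) (simp_all add: boolean_Con)
  next
    assume "Con \<phi> \<psi> \<in> w"
    then show "\<psi> \<in> w"
      by (intro closed'[of "[Con \<phi> \<psi>]"]) (simp_all add: boolean_Con)
  qed
  have not_both: "\<phi> \<notin> w \<or> Neg \<phi> \<notin> w" for \<phi>
  proof -
    have "EMN_thm (Neg (foldl Con \<phi> [Neg \<phi>]))"
      by (rule EMN_thm_if_boolean_valid) (simp add: boolean_simps)
    then have "\<not> set (\<phi> # [Neg \<phi>]) \<subseteq> w"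
      using w unfolding consistent_def by blast
    then show ?thesis
      by simp
  qed
  have one_of: "Neg \<phi> \<in> w" if "\<phi> \<notin> w" for \<phi>
  proof -
    obtain \<gamma>s where \<gamma>s: "set \<gamma>s \<subseteq> w" and refuted: "EMN_thm (Neg (foldl Con \<phi> \<gamma>s))"
      using refutable[OF \<open>\<phi> \<notin> w\<close>] by blast
    show ?thesis
      by (rule closed[OF \<gamma>s refuted]) (auto simp: boolean_Neg boolean_foldl_Con)
  qed
  have "world w"
    unfolding world_def boolean_def using thms Con not_both one_of by blast
  with \<Gamma>w show thesis
    using that by blast
qed

text \<open>A nontheorem \<open>\<phi>\<close> leaves \<open>{Neg \<phi>}\<close> consistent, hence \<open>Neg \<phi>\<close> in some world. Through this lemma,
  an inclusion of truth sets becomes a provable implication.\<close>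

lemma EMN_thm_if_in_all_worlds:
  assumes "\<And>w. world w \<Longrightarrow> \<phi> \<in> w"
  shows "EMN_thm \<phi>"
proof (rule ccontr)
  assume not_thm: "\<not> EMN_thm \<phi>"
  have "consistent EMN_thm {Neg \<phi>}"
    unfolding consistent_def
  proof (rule notI, elim exE conjE)
    fix \<gamma> \<gamma>s
    assume sub: "set (\<gamma> # \<gamma>s) \<subseteq> {Neg \<phi>}" and refuted: "EMN_thm (Neg (foldl Con \<gamma> \<gamma>s))"
    have "EMN_thm \<phi>"
      by (rule EMN_thm_boolean_consequence[OF refuted])
        (use sub in \<open>auto simp: boolean_Neg boolean_foldl_Con\<close>)
    with not_thm show False
      by blast
  qed
  then obtain w where "world w" "Neg \<phi> \<in> w"
    using consistent_extends_to_world[of "{Neg \<phi>}"] by auto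
  with assms show False
    by (simp add: world_simps)
qed

text \<open>By the rule RE\<open>\<Delta>\<close>: formulas that are in the same worlds are provably equivalent.\<close>

lemma world_Delta_cong:
  assumes "world s" and "\<And>w. world w \<Longrightarrow> \<phi> \<in> w \<longleftrightarrow> \<psi> \<in> w"
  shows "\<Delta> \<phi> \<in> s \<longleftrightarrow> \<Delta> \<psi> \<in> s"
proof -
  have "EMN_thm (Iff \<phi> \<psi>)"
    by (rule EMN_thm_if_in_all_worlds) (use assms(2) in \<open>simp add: world_simps\<close>)
  then have "EMN_thm (Iff (\<Delta> \<phi>) (\<Delta> \<psi>))"
    by (rule REDelta)
  then have "Iff (\<Delta> \<phi>) (\<Delta> \<psi>) \<in> s"
    using assms(1) by (rule world_EMN_thm[rotated])
  then show ?thesis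
    using assms(1) by (auto simp: world_simps)
qed


section \<open>The canonical model\<close>

definition necessary_at :: "'p fm set \<Rightarrow> 'p fm \<Rightarrow> bool" where
  "necessary_at s \<phi> \<longleftrightarrow> (\<forall>\<psi>. \<Delta> (Dis \<phi> \<psi>) \<in> s)"

definition truth_set :: "'p fm \<Rightarrow> 'p fm set set" where
  "truth_set \<phi> = {w. world w \<and> \<phi> \<in> w}"

lemma necessary_at_Top:
  assumes "world s"
  shows "necessary_at s Top"
  unfolding necessary_at_def
proof
  fix \<psi>
  have "\<Delta> (Dis Top \<psi>) \<in> s \<longleftrightarrow> \<Delta> Top \<in> s"
    by (rule world_Delta_cong[OF assms]) (simp add: world_simps)
  then show "\<Delta> (Dis Top \<psi>) \<in> s"
    using world_EMN_thm[OF assms DeltaN] by simp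
qed

text \<open>The alternatives in \<open>\<Delta>\<close>M have independent side formulas. Hence, if \<open>\<psi>\<close> shows that \<open>\<phi>\<close> is
  not necessary, fixing this \<open>\<psi>\<close> and varying \<open>\<chi>\<close> shows that \<open>Neg \<phi>\<close> is.\<close>

lemma Delta_imp_necessary_at:
  assumes "world s" and "\<Delta> \<phi> \<in> s"
  shows "necessary_at s \<phi> \<or> necessary_at s (Neg \<phi>)"
proof -
  have "\<Delta> (Dis \<phi> \<psi>) \<in> s \<or> \<Delta> (Dis (Neg \<phi>) \<chi>) \<in> s" for \<psi> \<chi>
    using world_EMN_thm[OF assms(1) DeltaM[of \<phi> \<psi> \<chi>]] assms by (simp add: world_simps)
  then show ?thesis
    unfolding necessary_at_def by blast
qed

lemma necessary_at_imp_Delta: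
  assumes s: "world s" and "necessary_at s \<chi>" and sub: "truth_set \<chi> \<subseteq> truth_set \<phi>"
  shows "\<Delta> \<phi> \<in> s"
proof -
  have "\<Delta> (Dis \<chi> \<phi>) \<in> s \<longleftrightarrow> \<Delta> \<phi> \<in> s"
    by (rule world_Delta_cong[OF s]) (use sub in \<open>auto simp: truth_set_def world_simps\<close>)
  with assms(2) show ?thesis
    by (simp add: necessary_at_def)
qed

lemma world_Delta_Neg: "world s \<Longrightarrow> \<Delta> (Neg \<phi>) \<in> s \<longleftrightarrow> \<Delta> \<phi> \<in> s"
  using world_EMN_thm[OF _ DeltaEqu[of \<phi>]] by (auto simp: world_simps)

definition canonical_nbhds :: "'p fm set \<Rightarrow> 'p fm set set set" where
  "canonical_nbhds s = {X. X \<subseteq> Collect world \<and> (\<exists>\<phi>. necessary_at s \<phi> \<and> truth_set \<phi> \<subseteq> X)}"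

definition canonical_model :: "('p fm set, 'p) nmodel" where
  "canonical_model =
    \<lparr>states = Collect world, nbhds = canonical_nbhds, val = \<lambda>p. truth_set (Atom p)\<rparr>"

lemma canonical_model_simps [simp]:
  "states canonical_model = Collect world"
  "nbhds canonical_model = canonical_nbhds"
  "val canonical_model = (\<lambda>p. truth_set (Atom p))"
  by (simp_all add: canonical_model_def)

lemma truth_set_Neg: "truth_set (Neg \<phi>) = Collect world - truth_set \<phi>"
  by (auto simp: truth_set_def world_simps)

lemma truth_set_mem_canonical_nbhds:
  "truth_set \<phi> \<in> canonical_nbhds s \<longleftrightarrow> (\<exists>\<chi>. necessary_at s \<chi> \<and> truth_set \<chi> \<subseteq> truth_set \<phi>)"
  by (auto simp: canonical_nbhds_def truth_set_def)

text \<open>The core of the truth lemma, stated for truth sets in place of satisfaction.\<close>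

lemma Delta_iff_canonical_nbhds:
  assumes s: "world s"
  shows "\<Delta> \<phi> \<in> s \<longleftrightarrow>
    truth_set \<phi> \<in> canonical_nbhds s \<or> truth_set (Neg \<phi>) \<in> canonical_nbhds s"
proof
  assume "\<Delta> \<phi> \<in> s"
  then show "truth_set \<phi> \<in> canonical_nbhds s \<or> truth_set (Neg \<phi>) \<in> canonical_nbhds s"
    unfolding truth_set_mem_canonical_nbhds using Delta_imp_necessary_at[OF s] by blast
next
  assume "truth_set \<phi> \<in> canonical_nbhds s \<or> truth_set (Neg \<phi>) \<in> canonical_nbhds s"
  then have "\<Delta> \<phi> \<in> s \<or> \<Delta> (Neg \<phi>) \<in> s"
    unfolding truth_set_mem_canonical_nbhds using necessary_at_imp_Delta[OF s] by blast
  then show "\<Delta> \<phi> \<in> s"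
    using world_Delta_Neg[OF s] by blast
qed

lemma sat_canonical_model:
  "world s \<Longrightarrow> sat canonical_model s \<phi> \<longleftrightarrow> \<phi> \<in> s"
proof (induction \<phi> arbitrary: s)
  case (Noncont \<phi>)
  have "{t. world t \<and> sat canonical_model t \<phi>} = truth_set \<phi>"
    using Noncont.IH by (auto simp: truth_set_def)
  then show ?case
    using Delta_iff_canonical_nbhds[OF Noncont.prems, of \<phi>] by (simp add: truth_set_Neg)
qed (simp_all add: world_simps truth_set_def)

lemma is_nmodel_canonical_model:
  assumes "world (s :: 'p fm set)"
  shows "is_nmodel (canonical_model :: ('p fm set, 'p) nmodel)"
  using assms
  by (auto simp: is_nmodel_def is_nframe_def frame_of_def canonical_nbhds_def truth_set_def)

lemma canonical_frame_mn:
  assumes "world (s :: 'p fm set)"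
  shows "frame_of (canonical_model :: ('p fm set, 'p) nmodel) \<in> mn_frames"
proof -
  let ?F = "frame_of (canonical_model :: ('p fm set, 'p) nmodel)"
  have "is_nframe ?F"
    using is_nmodel_canonical_model[OF assms] by (simp add: is_nmodel_def)
  moreover have "prop_m ?F"
    by (auto simp: prop_m_def frame_of_def canonical_nbhds_def intro: subset_trans)
  moreover have "prop_n ?F"
    using necessary_at_Top
    by (auto simp: prop_n_def frame_of_def canonical_nbhds_def truth_set_def)
  ultimately show ?thesis
    by (simp add: mn_frames_def)
qed


section \<open>Strong completeness\<close>

theorem theorem21:
  shows "strongly_complete (EMN_thm :: 'p fm \<Rightarrow> bool) (mn_frames :: 'p fm set nframe set)"
  unfolding strongly_complete_def
proof (intro allI impI)
  fix \<Gamma> :: "'p fm set"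
  assume cons: "consistent EMN_thm \<Gamma>"
  show "\<exists>M :: ('p fm set, 'p) nmodel. is_nmodel M \<and> frame_of M \<in> mn_frames \<and>
    (\<exists>s\<in>states M. \<forall>\<phi>\<in>\<Gamma>. sat M s \<phi>)"
  proof (cases "\<Gamma> = {}")
    case True
    \<comment> \<open>Any model on an \<open>(mn)\<close>-frame will do; this one has a single state.\<close>
    let ?M = "\<lparr>states = {{}}, nbhds = \<lambda>_. {{{}}}, val = \<lambda>_. {}\<rparr> :: ('p fm set, 'p) nmodel"
    have "is_nmodel ?M" "frame_of ?M \<in> mn_frames"
      by (auto simp: is_nmodel_def mn_frames_def is_nframe_def prop_m_def prop_n_def frame_of_def)
    moreover have "\<exists>s\<in>states ?M. \<forall>\<phi>\<in>\<Gamma>. sat ?M s \<phi>"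
      using True by simp
    ultimately show ?thesis
      by blast
  next
    case False
    then obtain w where w: "world w" "\<Gamma> \<subseteq> w"
      using consistent_extends_to_world[OF cons] by blast
    then have "\<exists>s\<in>states canonical_model. \<forall>\<phi>\<in>\<Gamma>. sat canonical_model s \<phi>"
      using sat_canonical_model[OF w(1)] by auto
    then show ?thesis
      using is_nmodel_canonical_model[OF w(1)] canonical_frame_mn[OF w(1)] by blast
  qed
qed

end
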